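(* Let $G\subset U_N^+$ be a closed quantum subgroup, let $I\subset\{1,\ldots,N\}$ be nonempty, and let $G\to X$ be an affine homogeneous space with index set $I$, with associated morphism $\alpha:C(X)\to C(G)$ and standard coordinates $x_1,\ldots,x_N\in C(X)$. Put $\int_X=\int\alpha$, where $\int$ is the Haar integration of $G$. Then for every colored integer $k=e_1\ldots e_k$ and all indices $i_1,\ldots,i_k\in\{1,\ldots,N\}$, $$\int_Xx_{i_1}^{e_1}\ldots x_{i_k}^{e_k}=\sum_{\pi,\sigma\in D}(\xi_\pi)_{i_1\ldots i_k}K_I(\sigma)W_{kN}(\pi,\sigma),$$ where $\{\xi_\pi\mid\pi\in D\}$ is any basis of $Fix(u^{\otimes k})$, where $$K_I(\sigma)=\frac{1}{\sqrt{|I|^k}}\sum_{b_1,\ldots,b_k\in I}\overline{(\xi_\sigma)_{b_1\ldots b_k}},$$ and where $W_{kN}=G_{kN}^{-1}$ is the inverse of the Gram matrix $G_{kN}(\pi,\sigma)=\langle\xi_\pi,\xi_\sigma\rangle$, $\pi,\sigma\in D$.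
   Context: Compact quantum groups. A finitely generated Hopf $C^*$-algebra is a unital $C^*$-algebra $A$ with a unitary matrix $u=(u_{ij})\in M_N(A)$ whose coefficients generate $A$, such that $\Delta(u_{ij})=\sum_ku_{ik}\otimes u_{kj}$, $\varepsilon(u_{ij})=\delta_{ij}$, $S(u_{ij})=u_{ji}^*$ define morphisms of $C^*$-algebras $\Delta:A\to A\otimes A$, $\varepsilon:A\to\mathbb C$, $S:A\to A^{opp}$. One writes $A=C(G)$, with $G$ a compact quantum group. Morphisms are unital $*$-homomorphisms; $\otimes$ is the minimal tensor product. $G$ has a unique Haar state $\int:C(G)\to\mathbb C$, with $(\int\otimes id)\Delta=(id\otimes\int)\Delta=\int(.)1$. $C(U_N^+)$ is the universal $C^*$-algebra generated by $u_{ij}$, $1\le i,j\le N$, with $u^*=u^{-1}$, $u^t=\bar u^{-1}$, and $C(S^{N-1}_{\mathbb C,+})$ is the universal $C^*$-algebra generated by $x_1,\ldots,x_N$ with $\sum_ix_ix_i^*=\sum_ix_i^*x_i=1$. A closed quantum subgroup $G\subset U_N^+$ is given by a (surjective) morphism $C(U_N^+)\to C(G)$ mapping standard coordinates to standard coordinates. An algebraic submanifold $X\subset S^{N-1}_{\mathbb C,+}$ is given by a quotient $C(X)$ of $C(S^{N-1}_{\mathbb C,+})$ by noncommutative $*$-polynomial relations between $x_1,\ldots,x_N$. An extended homogeneous space $G\to X$ consists of a morphism $\alpha:C(X)\to C(G)$ and a coaction $\Phi:C(X)\to C(G)\otimes C(X)$ (a morphism with $(id\otimes\Phi)\Phi=(\Delta\otimes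 id)\Phi$) such that $(id\otimes\alpha)\Phi=\Delta\alpha$ and $(\int\otimes id)\Phi=\int\alpha(.)1$. It is called affine (with index set $I$) when $X\subset S^{N-1}_{\mathbb C,+}$ is an algebraic submanifold, $G\subset U_N^+$ is a closed quantum subgroup, and $\alpha(x_i)=\frac{1}{\sqrt{|I|}}\sum_{b\in I}u_{ib}$, $\Phi(x_i)=\sum_au_{ia}\otimes x_a$. Colored integers: $k=e_1\ldots e_k$ with $e_i\in\{\circ,\bullet\}$; $k$ also denotes the length. $x^\circ=x$, $x^\bullet=x^*$, and similarly for $u_{ij}$. $u^{\otimes k}$ is the matrix with entries $(u^{\otimes k})_{i_1\ldots i_k,j_1\ldots j_k}=u_{i_1j_1}^{e_1}\ldots u_{i_kj_k}^{e_k}$, and $Fix(u^{\otimes k})=\{\xi\in(\mathbb C^N)^{\otimes k}\mid u^{\otimes k}\xi=\xi\}$. The scalar product is $\langle\xi,\eta\rangle=\sum_{i_1\ldots i_k}\overline{\xi_{i_1\ldots i_k}}\,\eta_{i_1\ldots i_k}$. *)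

theory Defs
  imports
    "HOL-Analysis.Analysis"
    "HOL-Library.Function_Algebras"
    "HOL-Library.Poly_Mapping"
    "HOL-Library.Nonpos_Ints"
begin

section \<open>Unital C*-algebras\<close>

text \<open>\<^class>\<open>real_normed_algebra_1\<close> forces \<open>0 \<noteq> 1\<close>. Only the zero algebra is lost; it occurs neither
  as \<open>C(G)\<close>, which carries a counit, nor as \<open>C(X)\<close>, which carries a unital morphism to \<open>C(G)\<close>.\<close>

class cstar_algebra = real_normed_algebra_1 + banach +
  fixes scaleC :: "complex \<Rightarrow> 'a \<Rightarrow> 'a" (infixr \<open>*\<^sub>C\<close> 75)
    and adj :: "'a \<Rightarrow> 'a" (\<open>(_\<^sup>\<star>)\<close> [1000] 1000)
  assumes scaleR_scaleC: "r *\<^sub>R a = complex_of_real r *\<^sub>C a"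
    and scaleC_add_right: "c *\<^sub>C (a + b) = c *\<^sub>C a + c *\<^sub>C b"
    and scaleC_add_left: "(c + d) *\<^sub>C a = c *\<^sub>C a + d *\<^sub>C a"
    and scaleC_scaleC: "c *\<^sub>C d *\<^sub>C a = (c * d) *\<^sub>C a"
    and mult_scaleC_left: "(c *\<^sub>C a) * b = c *\<^sub>C (a * b)"
    and mult_scaleC_right: "a * (c *\<^sub>C b) = c *\<^sub>C (a * b)"
    and norm_scaleC: "norm (c *\<^sub>C a) = cmod c * norm a"
    and adj_adj: "(a\<^sup>\<star>)\<^sup>\<star> = a"
    and adj_add: "(a + b)\<^sup>\<star> = a\<^sup>\<star> + b\<^sup>\<star>"
    and adj_scaleC: "(c *\<^sub>C a)\<^sup>\<star> = cnj c *\<^sub>C a\<^sup>\<star>"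
    and adj_mult: "(a * b)\<^sup>\<star> = b\<^sup>\<star> * a\<^sup>\<star>"
    and cstar_identity: "norm (a\<^sup>\<star> * a) = (norm a)\<^sup>2"

global_interpretation cvs: vector_space "scaleC :: complex \<Rightarrow> 'a \<Rightarrow> 'a :: cstar_algebra"
proof
  fix a :: 'a
  show "1 *\<^sub>C a = a"
    using scaleR_scaleC[of 1 a] by simp
qed (simp_all add: scaleC_add_right scaleC_add_left scaleC_scaleC)

instantiation complex :: cstar_algebra
begin

definition scaleC_complex :: "complex \<Rightarrow> complex \<Rightarrow> complex" where
  "scaleC_complex c z = c * z"

definition adj_complex :: "complex \<Rightarrow> complex" where
  "adj_complex z = cnj z"

instance
  by standard
    (simp_all add: scaleC_complex_def adj_complex_def scaleR_conv_of_real algebra_simps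
       norm_mult power2_eq_square)

end

abbreviation clinear :: "('a::cstar_algebra \<Rightarrow> 'b::cstar_algebra) \<Rightarrow> bool" where
  "clinear \<equiv> Vector_Spaces.linear scaleC scaleC"

text \<open>Continuity of morphisms is automatic.\<close>

definition cstar_hom :: "('a::cstar_algebra \<Rightarrow> 'b::cstar_algebra) \<Rightarrow> bool" where
  "cstar_hom f \<longleftrightarrow> clinear f \<and> f 1 = 1 \<and>
     (\<forall>a b. f (a * b) = f a * f b) \<and> (\<forall>a. f (a\<^sup>\<star>) = (f a)\<^sup>\<star>)"

text \<open>A morphism to the opposite algebra, which only differs by the order of multiplication.\<close>

definition cstar_opp_hom :: "('a::cstar_algebra \<Rightarrow> 'b::cstar_algebra) \<Rightarrow> bool" where
  "cstar_opp_hom f \<longleftrightarrow> clinear f \<and> f 1 = 1 \<and>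
     (\<forall>a b. f (a * b) = f b * f a) \<and> (\<forall>a. f (a\<^sup>\<star>) = (f a)\<^sup>\<star>)"

definition cstar_subalgebra :: "'a::cstar_algebra set \<Rightarrow> bool" where
  "cstar_subalgebra B \<longleftrightarrow> closed B \<and> cvs.subspace B \<and> 1 \<in> B \<and>
     (\<forall>a\<in>B. \<forall>b\<in>B. a * b \<in> B) \<and> (\<forall>a\<in>B. a\<^sup>\<star> \<in> B)"

definition closed_ideal :: "'a::cstar_algebra set \<Rightarrow> bool" where
  "closed_ideal J \<longleftrightarrow> closed J \<and> cvs.subspace J \<and> (\<forall>a. \<forall>b\<in>J. a * b \<in> J \<and> b * a \<in> J)"

text \<open>C*-seminorms on a complex *-algebra \<open>V\<close> (a subset of a ring) that need not be complete;
  scalar multiplication and involution are given explicitly.\<close>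

definition cstar_seminorm_on ::
    "(complex \<Rightarrow> 'a \<Rightarrow> 'a) \<Rightarrow> ('a \<Rightarrow> 'a) \<Rightarrow> 'a::ring set \<Rightarrow> ('a \<Rightarrow> real) \<Rightarrow> bool" where
  "cstar_seminorm_on smul star V p \<longleftrightarrow>
     (\<forall>a\<in>V. 0 \<le> p a) \<and>
     (\<forall>a\<in>V. \<forall>b\<in>V. p (a + b) \<le> p a + p b \<and> p (a * b) \<le> p a * p b) \<and>
     (\<forall>a\<in>V. \<forall>c. p (smul c a) = cmod c * p a) \<and>
     (\<forall>a\<in>V. p (star a * a) = (p a)\<^sup>2)"

definition cstar_norm_on ::
    "(complex \<Rightarrow> 'a \<Rightarrow> 'a) \<Rightarrow> ('a \<Rightarrow> 'a) \<Rightarrow> 'a::ring set \<Rightarrow> ('a \<Rightarrow> real) \<Rightarrow> bool" where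
  "cstar_norm_on smul star V p \<longleftrightarrow>
     cstar_seminorm_on smul star V p \<and> (\<forall>a\<in>V. p a = 0 \<longrightarrow> a = 0)"


section \<open>Minimal tensor products\<close>

text \<open>\<open>min_tensor t\<close> says that \<open>'c\<close>, together with \<open>t a b = a \<otimes> b\<close>, is the minimal tensor product of
  \<open>'a\<close> and \<open>'b\<close>: the span of the elementary tensors is (a copy of) the algebraic tensor product
  *-algebra, it is dense, and the norm of \<open>'c\<close> restricts to its smallest C*-norm.\<close>

definition min_tensor ::
    "('a::cstar_algebra \<Rightarrow> 'b::cstar_algebra \<Rightarrow> 'c::cstar_algebra) \<Rightarrow> bool" where
  "min_tensor t \<longleftrightarrow>
     (\<forall>a. clinear (t a)) \<and> (\<forall>b. clinear (\<lambda>a. t a b)) \<and>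
     (\<forall>B f. finite B \<and> \<not> cvs.dependent B \<and> (\<Sum>b\<in>B. t (f b) b) = 0 \<longrightarrow> (\<forall>b\<in>B. f b = 0)) \<and>
     t 1 1 = 1 \<and>
     (\<forall>a b a' b'. t a b * t a' b' = t (a * a') (b * b')) \<and>
     (\<forall>a b. (t a b)\<^sup>\<star> = t (a\<^sup>\<star>) (b\<^sup>\<star>)) \<and>
     closure (cvs.span (range (case_prod t))) = UNIV \<and>
     (\<forall>p. cstar_norm_on scaleC adj (cvs.span (range (case_prod t))) p \<longrightarrow>
        (\<forall>y \<in> cvs.span (range (case_prod t)). norm y \<le> p y))"

text \<open>\<open>tensor_map t t' f g h\<close> says that \<open>h = f \<otimes> g\<close>, the continuous linear map determined by
  \<open>h (a \<otimes> b) = f a \<otimes> g b\<close>. If \<open>f\<close> or \<open>g\<close> takes values in the complex numbers, the canonical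
  tensor product \<open>\<complex> \<otimes> B = B\<close> or \<open>A \<otimes> \<complex> = A\<close> on the target side is scalar multiplication.\<close>

definition tensor_map ::
    "('a \<Rightarrow> 'b \<Rightarrow> 'c::cstar_algebra) \<Rightarrow> ('d \<Rightarrow> 'e \<Rightarrow> 'f::cstar_algebra) \<Rightarrow>
     ('a \<Rightarrow> 'd) \<Rightarrow> ('b \<Rightarrow> 'e) \<Rightarrow> ('c \<Rightarrow> 'f) \<Rightarrow> bool" where
  "tensor_map t t' f g h \<longleftrightarrow>
     clinear h \<and> continuous_on UNIV h \<and> (\<forall>a b. h (t a b) = t' (f a) (g b))"


section \<open>Noncommutative *-polynomials and universal C*-algebras\<close>

datatype color = White | Black

primrec colored :: "color \<Rightarrow> 'a::cstar_algebra \<Rightarrow> 'a" where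
  "colored White a = a"
| "colored Black a = a\<^sup>\<star>"

definition monomial :: "('i \<Rightarrow> 'a::cstar_algebra) \<Rightarrow> ('i \<times> color) list \<Rightarrow> 'a" where
  "monomial x w = prod_list (map (\<lambda>(i, e). colored e (x i)) w)"

text \<open>Words in the letters \<open>X\<^sub>i\<close> and \<open>X\<^sub>i\<^sup>*\<close>, as a monoid under concatenation. With this the finitely
  supported functions from words to complex numbers are the free complex *-algebra on \<open>'i\<close>, with
  the convolution product of \<^theory>\<open>HOL-Library.Poly_Mapping\<close>.\<close>

datatype 'i ncword = NCWord (letters: "('i \<times> color) list")

instantiation ncword :: (type) monoid_add
begin

definition "0 = NCWord []"
definition "v + w = NCWord (letters v @ letters w)"

instance
  by standard (simp_all add: zero_ncword_def plus_ncword_def)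

end

type_synonym 'i ncpoly = "'i ncword \<Rightarrow>\<^sub>0 complex"

primrec flip :: "color \<Rightarrow> color" where
  "flip White = Black"
| "flip Black = White"

definition ncword_star :: "'i ncword \<Rightarrow> 'i ncword" where
  "ncword_star w = NCWord (rev (map (map_prod id flip) (letters w)))"

definition ncpoly_star :: "'i ncpoly \<Rightarrow> 'i ncpoly" where
  "ncpoly_star f = Poly_Mapping.map cnj (Poly_Mapping.map_key ncword_star f)"

definition ncpoly_scale :: "complex \<Rightarrow> 'i ncpoly \<Rightarrow> 'i ncpoly" where
  "ncpoly_scale c = Poly_Mapping.map ((*) c)"

definition var :: "'i \<Rightarrow> 'i ncpoly" where
  "var i = Poly_Mapping.single (NCWord [(i, White)]) 1"

definition ncpoly_eval :: "('i \<Rightarrow> 'a::cstar_algebra) \<Rightarrow> 'i ncpoly \<Rightarrow> 'a" where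
  "ncpoly_eval x f =
     (\<Sum>w\<in>Poly_Mapping.keys f. Poly_Mapping.lookup f w *\<^sub>C monomial x (letters w))"

text \<open>\<open>'a\<close> is the universal C*-algebra generated by the \<open>x i\<close> with relations \<open>r = 0\<close>, \<open>r \<in> R\<close>: its
  norm is the largest C*-seminorm on the free *-algebra vanishing on \<open>R\<close>. (For every family \<open>y\<close>
  satisfying \<open>R\<close> in a C*-algebra of any type, \<open>f \<mapsto> norm (ncpoly_eval y f)\<close> is such a seminorm.)\<close>

definition universal_cstar_algebra :: "'i ncpoly set \<Rightarrow> ('i \<Rightarrow> 'a::cstar_algebra) \<Rightarrow> bool" where
  "universal_cstar_algebra R x \<longleftrightarrow>
     cstar_subalgebra hull (range x) = UNIV \<and>
     (\<forall>r\<in>R. ncpoly_eval x r = 0) \<and>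
     (\<forall>p. cstar_seminorm_on ncpoly_scale ncpoly_star UNIV p \<and> (\<forall>r\<in>R. p r = 0) \<longrightarrow>
        (\<forall>f. p f \<le> norm (ncpoly_eval x f)))"

text \<open>Entrywise, the relations \<open>u u\<^sup>* = u\<^sup>* u = 1\<close> and, for the matrix \<open>w\<close> with \<open>w\<^sub>i\<^sub>j = u\<^sub>i\<^sub>j\<^sup>*\<close>,
  \<open>u\<^sup>t w = w u\<^sup>t = 1\<close>, which define \<open>C(U\<^sub>N\<^sup>+)\<close>.\<close>

definition free_unitary_relations :: "('n::finite \<times> 'n) ncpoly set" where
  "free_unitary_relations = (\<Union>i. \<Union>j. let d = (if i = j then 1 else 0) in
     {(\<Sum>k\<in>UNIV. var (i, k) * ncpoly_star (var (j, k))) - d,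
      (\<Sum>k\<in>UNIV. ncpoly_star (var (k, i)) * var (k, j)) - d,
      (\<Sum>k\<in>UNIV. var (k, i) * ncpoly_star (var (k, j))) - d,
      (\<Sum>k\<in>UNIV. ncpoly_star (var (i, k)) * var (j, k)) - d})"

definition free_sphere_relations :: "'n::finite ncpoly set" where
  "free_sphere_relations =
     {(\<Sum>i\<in>UNIV. var i * ncpoly_star (var i)) - 1,
      (\<Sum>i\<in>UNIV. ncpoly_star (var i) * var i) - 1}"


section \<open>Compact quantum groups and affine homogeneous spaces\<close>

text \<open>The matrix size is \<open>N = CARD('n)\<close>. A type \<open>'g\<close> with this structure is \<open>C(G)\<close>, and the
  map \<open>tGG\<close> exhibits \<open>'gg\<close> as \<open>C(G) \<otimes> C(G)\<close>.\<close>

locale hopf_cstar_algebra =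
  fixes u :: "'n::finite \<Rightarrow> 'n \<Rightarrow> 'g::cstar_algebra"
    and tGG :: "'g \<Rightarrow> 'g \<Rightarrow> 'gg::cstar_algebra"
    and \<Delta> :: "'g \<Rightarrow> 'gg"
    and \<epsilon> :: "'g \<Rightarrow> complex"
    and S :: "'g \<Rightarrow> 'g"
  assumes unitary_right: "(\<Sum>k\<in>UNIV. u i k * (u j k)\<^sup>\<star>) = (if i = j then 1 else 0)"
    and unitary_left: "(\<Sum>k\<in>UNIV. (u k i)\<^sup>\<star> * u k j) = (if i = j then 1 else 0)"
    and generates: "cstar_subalgebra hull (range (case_prod u)) = UNIV"
    and tGG: "min_tensor tGG"
    and comult_hom: "cstar_hom \<Delta>"
    and comult: "\<Delta> (u i j) = (\<Sum>k\<in>UNIV. tGG (u i k) (u k j))"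
    and counit_hom: "cstar_hom \<epsilon>"
    and counit: "\<epsilon> (u i j) = (if i = j then 1 else 0)"
    and antipode_hom: "cstar_opp_hom S"
    and antipode: "S (u i j) = (u j i)\<^sup>\<star>"

text \<open>The equations are \<open>(\<integral> \<otimes> id)\<Delta> = (id \<otimes> \<integral>)\<Delta> = \<integral>(.)1\<close>. The maps \<open>\<integral> \<otimes> id\<close> and \<open>id \<otimes> \<integral>\<close> always exist on
  a minimal tensor product, so the existential quantifiers merely name them.\<close>

definition haar_state ::
    "('g::cstar_algebra \<Rightarrow> 'g \<Rightarrow> 'gg::cstar_algebra) \<Rightarrow> ('g \<Rightarrow> 'gg) \<Rightarrow> ('g \<Rightarrow> complex) \<Rightarrow> bool" where
  "haar_state tGG \<Delta> \<phi> \<longleftrightarrow>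
     clinear \<phi> \<and> \<phi> 1 = 1 \<and> (\<forall>a. \<phi> (a\<^sup>\<star> * a) \<in> \<real>\<^sub>\<ge>\<^sub>0) \<and>
     (\<exists>h. tensor_map tGG (\<lambda>c b. c *\<^sub>C b) \<phi> id h \<and> (\<forall>a. h (\<Delta> a) = \<phi> a *\<^sub>C 1)) \<and>
     (\<exists>h. tensor_map tGG (\<lambda>a c. c *\<^sub>C a) id \<phi> h \<and> (\<forall>a. h (\<Delta> a) = \<phi> a *\<^sub>C 1))"

text \<open>The type \<open>'ggx\<close> is \<open>C(G) \<otimes> C(G) \<otimes> C(X)\<close>, which is a tensor product in the two ways \<open>tG_GX\<close> and
  \<open>tGG_X\<close>, matched by associativity. As above, the existential quantifiers only name the
  tensor products of maps \<open>id \<otimes> \<Phi>\<close>, \<open>\<Delta> \<otimes> id\<close>, \<open>id \<otimes> \<alpha>\<close> and \<open>\<integral> \<otimes> id\<close>.\<close>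

locale extended_homogeneous_space = hopf_cstar_algebra u tGG \<Delta> \<epsilon> S
  for u :: "'n::finite \<Rightarrow> 'n \<Rightarrow> 'g::cstar_algebra"
    and tGG :: "'g \<Rightarrow> 'g \<Rightarrow> 'gg::cstar_algebra"
    and \<Delta> \<epsilon> S +
  fixes haar :: "'g \<Rightarrow> complex"
    and tGX :: "'g \<Rightarrow> 'x::cstar_algebra \<Rightarrow> 'gx::cstar_algebra"
    and tG_GX :: "'g \<Rightarrow> 'gx \<Rightarrow> 'ggx::cstar_algebra"
    and tGG_X :: "'gg \<Rightarrow> 'x \<Rightarrow> 'ggx"
    and \<alpha> :: "'x \<Rightarrow> 'g"
    and \<Phi> :: "'x \<Rightarrow> 'gx"
  assumes haar: "haar_state tGG \<Delta> haar"
    and tGX: "min_tensor tGX"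
    and tG_GX: "min_tensor tG_GX"
    and tGG_X: "min_tensor tGG_X"
    and tensor_assoc: "tG_GX a (tGX b f) = tGG_X (tGG a b) f"
    and alpha_hom: "cstar_hom \<alpha>"
    and Phi_hom: "cstar_hom \<Phi>"
    and coaction:
      "\<exists>h h'. tensor_map tGX tG_GX id \<Phi> h \<and> tensor_map tGX tGG_X \<Delta> id h' \<and>
         (\<forall>f. h (\<Phi> f) = h' (\<Phi> f))"
    and alpha_equivariant:
      "\<exists>h. tensor_map tGX tGG id \<alpha> h \<and> (\<forall>f. h (\<Phi> f) = \<Delta> (\<alpha> f))"
    and ergodic:
      "\<exists>h. tensor_map tGX (\<lambda>c f. c *\<^sub>C f) haar id h \<and> (\<forall>f. h (\<Phi> f) = haar (\<alpha> f) *\<^sub>C 1)"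

definition closed_subgroup_of_free_unitary ::
    "('n::finite \<Rightarrow> 'n \<Rightarrow> 'v::cstar_algebra) \<Rightarrow> ('v \<Rightarrow> 'g::cstar_algebra) \<Rightarrow> ('n \<Rightarrow> 'n \<Rightarrow> 'g) \<Rightarrow> bool"
where
  "closed_subgroup_of_free_unitary v \<rho> u \<longleftrightarrow>
     universal_cstar_algebra free_unitary_relations (case_prod v) \<and>
     cstar_hom \<rho> \<and> surj \<rho> \<and> (\<forall>i j. \<rho> (v i j) = u i j)"

definition algebraic_submanifold ::
    "('n::finite \<Rightarrow> 's::cstar_algebra) \<Rightarrow> ('s \<Rightarrow> 'x::cstar_algebra) \<Rightarrow> ('n \<Rightarrow> 'x) \<Rightarrow> bool" where
  "algebraic_submanifold z q x \<longleftrightarrow>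
     universal_cstar_algebra free_sphere_relations z \<and>
     cstar_hom q \<and> surj q \<and> (\<forall>i. q (z i) = x i) \<and>
     (\<exists>R. {a. q a = 0} = closed_ideal hull (ncpoly_eval z ` R))"

text \<open>\<open>v\<close> are the standard coordinates of \<open>C(U\<^sub>N\<^sup>+)\<close> and \<open>z\<close> those of the free complex sphere.\<close>

locale affine_homogeneous_space =
  extended_homogeneous_space u tGG \<Delta> \<epsilon> S haar tGX tG_GX tGG_X \<alpha> \<Phi>
  for u :: "'n::finite \<Rightarrow> 'n \<Rightarrow> 'g::cstar_algebra"
    and tGG :: "'g \<Rightarrow> 'g \<Rightarrow> 'gg::cstar_algebra"
    and \<Delta> \<epsilon> S haar
    and tGX :: "'g \<Rightarrow> 'x::cstar_algebra \<Rightarrow> 'gx::cstar_algebra"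
    and tG_GX :: "'g \<Rightarrow> 'gx \<Rightarrow> 'ggx::cstar_algebra"
    and tGG_X \<alpha> \<Phi> +
  fixes v :: "'n \<Rightarrow> 'n \<Rightarrow> 'v::cstar_algebra"
    and \<rho> :: "'v \<Rightarrow> 'g"
    and z :: "'n \<Rightarrow> 's::cstar_algebra"
    and q :: "'s \<Rightarrow> 'x"
    and x :: "'n \<Rightarrow> 'x"
    and I :: "'n set"
  assumes subgroup: "closed_subgroup_of_free_unitary v \<rho> u"
    and submanifold: "algebraic_submanifold z q x"
    and index_nonempty: "I \<noteq> {}"
    and alpha_coord: "\<alpha> (x i) = (1 / sqrt (card I)) *\<^sub>R (\<Sum>b\<in>I. u i b)"
    and Phi_coord: "\<Phi> (x i) = (\<Sum>a\<in>UNIV. tGX (u i a) (x a))"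


section \<open>Fixed vectors, Gram matrix and Weingarten matrix\<close>

text \<open>A tensor in \<open>(\<complex>\<^sup>N)\<^sup>\<otimes>\<^sup>k\<close> is a function on lists of indices that vanishes on lists of length
  other than \<open>k\<close>; the vector space structure is the pointwise one.\<close>

global_interpretation tensors:
  vector_space "\<lambda>(c::complex) (\<xi> :: 'n list \<Rightarrow> complex) is. c * \<xi> is"
  by standard (simp_all add: fun_eq_iff algebra_simps)

definition tensor_power ::
    "('n \<Rightarrow> 'n \<Rightarrow> 'g::cstar_algebra) \<Rightarrow> color list \<Rightarrow> 'n list \<Rightarrow> 'n list \<Rightarrow> 'g" where
  "tensor_power u es is js = monomial (case_prod u) (zip (zip is js) es)"

definition Fix :: "('n::finite \<Rightarrow> 'n \<Rightarrow> 'g::cstar_algebra) \<Rightarrow> color list \<Rightarrow> ('n list \<Rightarrow> complex) set" where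
  "Fix u es = {\<xi>. (\<forall>is. length is \<noteq> length es \<longrightarrow> \<xi> is = 0) \<and>
     (\<forall>is. length is = length es \<longrightarrow>
        (\<Sum>js | length js = length es. \<xi> js *\<^sub>C tensor_power u es is js) = \<xi> is *\<^sub>C 1)}"

definition tensor_basis ::
    "'d set \<Rightarrow> ('d \<Rightarrow> 'n list \<Rightarrow> complex) \<Rightarrow> ('n list \<Rightarrow> complex) set \<Rightarrow> bool" where
  "tensor_basis D \<xi> V \<longleftrightarrow>
     inj_on \<xi> D \<and> \<not> tensors.dependent (\<xi> ` D) \<and> tensors.span (\<xi> ` D) = V"

definition tensor_inner ::
    "nat \<Rightarrow> ('n::finite list \<Rightarrow> complex) \<Rightarrow> ('n list \<Rightarrow> complex) \<Rightarrow> complex" where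
  "tensor_inner k \<xi> \<eta> = (\<Sum>is | length is = k. cnj (\<xi> is) * \<eta> is)"

text \<open>Matrices indexed by \<open>D\<close> are extended by 0, which makes the inverse unique as a function.\<close>

definition inverse_matrix_on :: "'d set \<Rightarrow> ('d \<Rightarrow> 'd \<Rightarrow> complex) \<Rightarrow> 'd \<Rightarrow> 'd \<Rightarrow> complex" where
  "inverse_matrix_on D M = (THE W.
     (\<forall>\<pi> \<sigma>. \<pi> \<notin> D \<or> \<sigma> \<notin> D \<longrightarrow> W \<pi> \<sigma> = 0) \<and>
     (\<forall>\<pi>\<in>D. \<forall>\<sigma>\<in>D. (\<Sum>\<tau>\<in>D. M \<pi> \<tau> * W \<tau> \<sigma>) = (if \<pi> = \<sigma> then 1 else 0) \<and>
                    (\<Sum>\<tau>\<in>D. W \<pi> \<tau> * M \<tau> \<sigma>) = (if \<pi> = \<sigma> then 1 else 0)))"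

definition gram :: "nat \<Rightarrow> ('d \<Rightarrow> 'n::finite list \<Rightarrow> complex) \<Rightarrow> 'd \<Rightarrow> 'd \<Rightarrow> complex" where
  "gram k \<xi> \<pi> \<sigma> = tensor_inner k (\<xi> \<pi>) (\<xi> \<sigma>)"

definition weingarten ::
    "nat \<Rightarrow> 'd set \<Rightarrow> ('d \<Rightarrow> 'n::finite list \<Rightarrow> complex) \<Rightarrow> 'd \<Rightarrow> 'd \<Rightarrow> complex" where
  "weingarten k D \<xi> = inverse_matrix_on D (gram k \<xi>)"

definition K_coeff ::
    "nat \<Rightarrow> 'n::finite set \<Rightarrow> ('d \<Rightarrow> 'n list \<Rightarrow> complex) \<Rightarrow> 'd \<Rightarrow> complex" where
  "K_coeff k I \<xi> \<sigma> =
     1 / complex_of_real (sqrt (real (card I) ^ k)) *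
       (\<Sum>bs | length bs = k \<and> set bs \<subseteq> I. cnj (\<xi> \<sigma> bs))"

end

theory Submission
  imports Defs
begin

text \<open>Write \<open>\<integral>\<close> for the Haar state, \<open>I\<^sup>k\<close> for the words of length \<open>k\<close> over \<open>I\<close>, and let \<open>P\<close> be the matrix
  with entries \<open>P\<^sub>i\<^sub>j = \<integral> u\<^sup>\<otimes>\<^sup>k\<^sub>i\<^sub>j\<close>, where \<open>i\<close>, \<open>j\<close> are multi-indices. Since
  \<open>\<alpha>(x\<^sub>i) = c \<Sum>\<^sub>b u\<^sub>i\<^sub>b\<close> with \<open>c = 1 / sqrt |I|\<close> and \<open>b\<close> running over \<open>I\<close>, multiplying
  out the image under \<open>\<alpha>\<close> of a monomial of length \<open>k\<close> turns its integral into \<open>c\<^sup>k (P \<eta>)\<^sub>i\<close>, where \<open>\<eta>\<close> is the indicator function of \<open>I\<^sup>k\<close>.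

  The point is that \<open>P\<close> is the orthogonal projection onto \<open>Fix (u\<^sup>\<otimes>\<^sup>k)\<close>. Its columns are fixed vectors
  because \<open>\<Delta>(u\<^sup>\<otimes>\<^sup>k) = u\<^sup>\<otimes>\<^sup>k \<otimes> u\<^sup>\<otimes>\<^sup>k\<close> as matrices and the Haar state is invariant
  (\<open>haar_matrix_column_fixed\<close>). Integrating \<open>u\<^sup>\<otimes>\<^sup>k \<xi> = \<xi>\<close> shows that \<open>P \<xi> = \<xi>\<close> for fixed \<open>\<xi>\<close>
  (\<open>haar_matrix_fixes_Fix\<close>). Finally \<open>u\<^sup>\<otimes>\<^sup>k\<close> is an isometry, so that a fixed vector also satisfies
  \<open>\<xi>\<^sup>* u\<^sup>\<otimes>\<^sup>k = \<xi>\<^sup>*\<close>, and integration gives \<open>\<xi>\<^sup>* P = \<xi>\<^sup>*\<close>, that is, \<open>\<langle>\<xi>, P \<eta>\<rangle> = \<langle>\<xi>, \<eta>\<rangle>\<close>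
  (\<open>haar_matrix_left_Fix\<close>).

  The rest is linear algebra: in terms of a basis \<open>\<xi>\<^sub>\<pi>\<close> of its range, an orthogonal projection is
  \<open>P \<eta> = \<Sum>\<^sub>\<pi>\<^sub>\<sigma> W(\<pi>,\<sigma>) \<langle>\<xi>\<^sub>\<sigma>, \<eta>\<rangle> \<xi>\<^sub>\<pi>\<close> with \<open>W\<close> the inverse of the Gram matrix (\<open>weingarten_projection\<close>). For the
  indicator \<open>\<eta>\<close>, the factor \<open>\<langle>\<xi>\<^sub>\<sigma>, \<eta>\<rangle>\<close> is the sum in \<open>K\<^sub>I(\<sigma>)\<close>.\<close>


section \<open>Sums over words\<close>

lemma sum_lists_length_Suc:
  assumes "finite A"
  shows "(\<Sum>bs | length bs = Suc k \<and> set bs \<subseteq> A. f bs) =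
    (\<Sum>b\<in>A. \<Sum>bs | length bs = k \<and> set bs \<subseteq> A. f (b # bs))"
proof -
  let ?L = "{bs. length bs = k \<and> set bs \<subseteq> A}"
  have eq: "{bs. length bs = Suc k \<and> set bs \<subseteq> A} = case_prod (#) ` (A \<times> ?L)"
    by (auto simp: length_Suc_conv image_iff)
  have "inj_on (case_prod (#)) (A \<times> ?L)"
    by (auto simp: inj_on_def)
  then show ?thesis
    unfolding eq by (simp add: sum.reindex sum.cartesian_product case_prod_unfold)
qed

lemma sum_index_Suc:
  "(\<Sum>js | length js = Suc k. f js) = (\<Sum>j\<in>UNIV. \<Sum>js | length js = k. f (j # js :: 'n::finite list))"
  using sum_lists_length_Suc[of UNIV f k] by simp

lemma sum_fun_apply:
  "(\<Sum>i\<in>A. f i) x = (\<Sum>i\<in>A. f i x :: 'b::comm_monoid_add)"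
  by (induction A rule: infinite_finite_induct) simp_all

lemma finite_lists_of_length: "finite {js :: 'n::finite list. length js = k}"
  using finite_lists_length_eq[of "UNIV :: 'n set" k] by simp

section \<open>Tensor powers under morphisms\<close>

lemma adj_zero [simp]: "(0::'a::cstar_algebra)\<^sup>\<star> = 0"
  using adj_add[of "0::'a" 0] by simp

lemma adj_one [simp]: "(1::'a::cstar_algebra)\<^sup>\<star> = 1"
  by (metis adj_adj adj_mult mult.right_neutral)

lemma adj_sum: "(\<Sum>i\<in>A. f i)\<^sup>\<star> = (\<Sum>i\<in>A. (f i :: 'a::cstar_algebra)\<^sup>\<star>)"
  by (induction A rule: infinite_finite_induct) (simp_all add: adj_add)

lemma colored_sum: "colored e (\<Sum>i\<in>A. f i) = (\<Sum>i\<in>A. colored e (f i))"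
  by (cases e) (simp_all add: adj_sum)

lemma colored_scaleR: "colored e (r *\<^sub>R a) = r *\<^sub>R colored e a"
  by (cases e) (simp_all add: scaleR_scaleC adj_scaleC)

lemma clinear_sum: "clinear f \<Longrightarrow> f (\<Sum>i\<in>A. g i) = (\<Sum>i\<in>A. f (g i))"
  using module_hom.sum Vector_Spaces.linear_iff_module_hom by blast

lemma clinear_scaleC: "clinear f \<Longrightarrow> f (c *\<^sub>C a) = c *\<^sub>C f a"
  using module_hom.scale Vector_Spaces.linear_iff_module_hom by blast

lemma cstar_hom_colored: "cstar_hom f \<Longrightarrow> f (colored e a) = colored e (f a)"
  by (cases e) (simp_all add: cstar_hom_def)

lemma cstar_hom_monomial: "cstar_hom f \<Longrightarrow> f (monomial x w) = monomial (\<lambda>i. f (x i)) w"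
  by (induction w) (auto simp: monomial_def cstar_hom_colored, auto simp: cstar_hom_def cstar_hom_colored)

lemma tensor_power_Nil [simp]: "tensor_power u [] is js = 1"
  by (simp add: tensor_power_def monomial_def)

lemma tensor_power_Cons [simp]:
  "tensor_power u (e # es) (i # is) (j # js) = colored e (u i j) * tensor_power u es is js"
  by (simp add: tensor_power_def monomial_def)

text \<open>Multiplying out the product of the sums. With \<open>A = I\<close> and \<open>c = 1 / sqrt |I|\<close>,
  the left side is the image under \<open>\<alpha>\<close> of a monomial in the coordinates of an affine homogeneous space.\<close>

lemma monomial_row_sums:
  assumes "length is = length es" and "finite A"
  shows "monomial (\<lambda>i. c *\<^sub>R (\<Sum>b\<in>A. u i b)) (zip is es) =
    (c ^ length es) *\<^sub>R (\<Sum>bs | length bs = length es \<and> set bs \<subseteq> A. tensor_power u es is bs)"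
  using assms(1)
proof (induction "is" es rule: list_induct2)
  case Nil
  have "{bs. bs = [] \<and> set bs \<subseteq> A} = {[]}" by auto
  then show ?case by (simp add: monomial_def)
next
  case (Cons i "is" e es)
  let ?L = "{bs. length bs = length es \<and> set bs \<subseteq> A}"
  have "monomial (\<lambda>i. c *\<^sub>R (\<Sum>b\<in>A. u i b)) (zip (i # is) (e # es)) =
    (c *\<^sub>R (\<Sum>b\<in>A. colored e (u i b))) *
      ((c ^ length es) *\<^sub>R (\<Sum>bs\<in>?L. tensor_power u es is bs))"
    using Cons.IH by (simp add: monomial_def colored_scaleR colored_sum)
  also have "\<dots> = (c ^ Suc (length es)) *\<^sub>R
      (\<Sum>b\<in>A. \<Sum>bs\<in>?L. tensor_power u (e # es) (i # is) (b # bs))"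
    by (simp add: sum_product)
  finally show ?case
    by (simp add: sum_lists_length_Suc[OF assms(2)])
qed

section \<open>Comultiplication and fixed vectors of tensor powers\<close>

lemma min_tensor_adj: "min_tensor t \<Longrightarrow> (t a b)\<^sup>\<star> = t (a\<^sup>\<star>) (b\<^sup>\<star>)"
  by (simp add: min_tensor_def)

lemma min_tensor_mult: "min_tensor t \<Longrightarrow> t a b * t a' b' = t (a * a') (b * b')"
  by (simp add: min_tensor_def)

lemma min_tensor_one: "min_tensor t \<Longrightarrow> t 1 1 = 1"
  by (simp add: min_tensor_def)

context hopf_cstar_algebra
begin

text \<open>The antipode is what makes the entrywise adjoint \<open>w\<^sub>i\<^sub>j = u\<^sub>i\<^sub>j\<^sup>*\<close> an isometry as well: it maps
  \<open>u\<^sub>j\<^sub>k u\<^sub>i\<^sub>k\<^sup>*\<close> to \<open>u\<^sub>k\<^sub>i u\<^sub>k\<^sub>j\<^sup>*\<close>, hence \<open>u u\<^sup>* = 1\<close> to this relation.\<close>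

lemma conjugate_unitary_left: "(\<Sum>k\<in>UNIV. u k i * (u k j)\<^sup>\<star>) = (if i = j then 1 else 0)"
proof -
  have lin: "clinear S" and S1: "S 1 = 1"
    and Sm: "\<And>a b. S (a * b) = S b * S a" and Sa: "\<And>a. S (a\<^sup>\<star>) = (S a)\<^sup>\<star>"
    using antipode_hom by (auto simp: cstar_opp_hom_def)
  have "(\<Sum>k\<in>UNIV. u k i * (u k j)\<^sup>\<star>) = S (\<Sum>k\<in>UNIV. u j k * (u i k)\<^sup>\<star>)"
    by (simp add: clinear_sum[OF lin] Sm Sa antipode adj_adj)
  also have "\<dots> = (if i = j then 1 else 0)"
    unfolding unitary_right using S1 clinear_sum[OF lin, of _ "{}"] by auto
  finally show ?thesis .
qed

lemma colored_unitary_left: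
  "(\<Sum>k\<in>UNIV. (colored e (u k i))\<^sup>\<star> * colored e (u k j)) = (if i = j then 1 else 0)"
  by (cases e) (simp_all add: unitary_left conjugate_unitary_left adj_adj)

text \<open>In \<open>(a b)\<^sup>* (c d) = b\<^sup>* (a\<^sup>* c) d\<close> the outermost letter of the word ends up in the middle. Summing over
  its row index first therefore collapses the sum, one letter at a time.\<close>

lemma tensor_power_isometry:
  assumes "length js = length es" "length ls = length es"
  shows "(\<Sum>is | length is = length es. (tensor_power u es is js)\<^sup>\<star> * tensor_power u es is ls) =
    (if js = ls then 1 else 0)"
  using assms
proof (induction es arbitrary: js ls)
  case Nil
  then show ?case by simp
next
  case (Cons e es)
  obtain j js' l ls' where [simp]: "js = j # js'" "ls = l # ls'"
    using Cons.prems by (metis length_Suc_conv)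
  let ?L = "{is :: 'n list. length is = length es}"
  let ?T = "tensor_power u es"
  have "(\<Sum>is | length is = length (e # es).
        (tensor_power u (e # es) is js)\<^sup>\<star> * tensor_power u (e # es) is ls) =
      (\<Sum>i\<in>UNIV. \<Sum>is\<in>?L. (?T is js')\<^sup>\<star> * ((colored e (u i j))\<^sup>\<star> * colored e (u i l)) * ?T is ls')"
    by (simp add: sum_index_Suc adj_mult mult.assoc)
  also have "\<dots> = (\<Sum>is\<in>?L. (?T is js')\<^sup>\<star> *
      (\<Sum>i\<in>UNIV. (colored e (u i j))\<^sup>\<star> * colored e (u i l)) * ?T is ls')"
    by (subst sum.swap) (simp add: sum_distrib_left sum_distrib_right)
  also have "\<dots> = (if j = l then \<Sum>is\<in>?L. (?T is js')\<^sup>\<star> * ?T is ls' else 0)"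
    by (simp add: colored_unitary_left)
  also have "\<dots> = (if js = ls then 1 else 0)"
    using Cons by simp
  finally show ?case .
qed

lemma comult_colored: "\<Delta> (colored e (u i j)) = (\<Sum>k\<in>UNIV. tGG (colored e (u i k)) (colored e (u k j)))"
  using cstar_hom_colored[OF comult_hom, of e "u i j"]
  by (cases e) (simp_all add: comult adj_sum min_tensor_adj[OF tGG])

lemma comult_tensor_power:
  assumes "length is = length es" "length js = length es"
  shows "\<Delta> (tensor_power u es is js) =
    (\<Sum>ls | length ls = length es. tGG (tensor_power u es is ls) (tensor_power u es ls js))"
  using assms
proof (induction es arbitrary: "is" js)
  case Nil
  then show ?case
    using comult_hom by (simp add: min_tensor_one[OF tGG] cstar_hom_def)
next
  case (Cons e es)
  obtain i is' j js' where [simp]: "is = i # is'" "js = j # js'"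
    using Cons.prems by (metis length_Suc_conv)
  have "\<Delta> (tensor_power u (e # es) is js) =
      \<Delta> (colored e (u i j)) * \<Delta> (tensor_power u es is' js')"
    using comult_hom by (simp add: cstar_hom_def)
  also have "\<dots> = (\<Sum>k\<in>UNIV. \<Sum>ls | length ls = length es.
      tGG (tensor_power u (e # es) is (k # ls)) (tensor_power u (e # es) (k # ls) js))"
    using Cons by (simp add: comult_colored sum_product min_tensor_mult[OF tGG])
  finally show ?case by (simp add: sum_index_Suc)
qed

text \<open>Apply the adjoint \<open>U\<^sup>*\<close> of the isometry \<open>U = u\<^sup>\<otimes>\<^sup>k\<close> to \<open>U \<xi> = \<xi>\<close> to get
  \<open>\<xi> = U\<^sup>* \<xi>\<close>, and take adjoints.\<close>

lemma Fix_left_invariant: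
  assumes "\<xi> \<in> Fix u es" "length js = length es"
  shows "(\<Sum>is | length is = length es. cnj (\<xi> is) *\<^sub>C tensor_power u es is js) = cnj (\<xi> js) *\<^sub>C 1"
proof -
  let ?L = "{is :: 'n list. length is = length es}"
  let ?T = "tensor_power u es"
  have "(\<Sum>is\<in>?L. \<xi> is *\<^sub>C (?T is js)\<^sup>\<star>) = (\<Sum>is\<in>?L. (?T is js)\<^sup>\<star> * (\<xi> is *\<^sub>C 1))"
    by (simp add: mult_scaleC_right)
  also have "\<dots> = (\<Sum>is\<in>?L. (?T is js)\<^sup>\<star> * (\<Sum>ls\<in>?L. \<xi> ls *\<^sub>C ?T is ls))"
    using assms(1) by (intro sum.cong) (auto simp: Fix_def)
  also have "\<dots> = (\<Sum>ls\<in>?L. \<xi> ls *\<^sub>C (\<Sum>is\<in>?L. (?T is js)\<^sup>\<star> * ?T is ls))"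
    by (simp add: sum_distrib_left cvs.scale_sum_right mult_scaleC_right) (rule sum.swap)
  also have "\<dots> = (\<Sum>ls\<in>?L. if js = ls then \<xi> ls *\<^sub>C 1 else 0)"
    using assms(2) by (intro sum.cong) (auto simp: tensor_power_isometry)
  also have "\<dots> = \<xi> js *\<^sub>C 1"
    using assms(2) by (simp add: finite_lists_of_length)
  finally have "(\<Sum>is\<in>?L. \<xi> is *\<^sub>C (?T is js)\<^sup>\<star>)\<^sup>\<star> = (\<xi> js *\<^sub>C 1)\<^sup>\<star>"
    by simp
  then show ?thesis
    by (simp add: adj_sum adj_scaleC adj_adj)
qed

end

section \<open>Integration as the projection onto the fixed vectors\<close>

text \<open>The entries vanish off the words of the right length, so that the columns are tensors in
  the sense of \<^const>\<open>Fix\<close>.\<close>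

definition haar_matrix ::
    "('g::cstar_algebra \<Rightarrow> complex) \<Rightarrow> ('n \<Rightarrow> 'n \<Rightarrow> 'g) \<Rightarrow> color list \<Rightarrow> 'n list \<Rightarrow> 'n list \<Rightarrow> complex"
where
  "haar_matrix haar u es is js =
     (if length is = length es then haar (tensor_power u es is js) else 0)"

context hopf_cstar_algebra
begin

text \<open>Applying \<open>id \<otimes> \<integral>\<close> to \<open>\<Delta> (u\<^sup>\<otimes>\<^sup>k) = u\<^sup>\<otimes>\<^sup>k \<otimes> u\<^sup>\<otimes>\<^sup>k\<close> gives \<open>u\<^sup>\<otimes>\<^sup>k P = P\<close>.\<close>

lemma haar_matrix_column_fixed:
  assumes "haar_state tGG \<Delta> haar" "length js = length es"
  shows "(\<lambda>is. haar_matrix haar u es is js) \<in> Fix u es"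
proof -
  obtain h where h: "tensor_map tGG (\<lambda>a c. c *\<^sub>C a) id haar h" "\<And>a. h (\<Delta> a) = haar a *\<^sub>C 1"
    using assms(1) by (auto simp: haar_state_def)
  have lin: "clinear h" and ht: "\<And>a b. h (tGG a b) = haar b *\<^sub>C a"
    using h(1) by (auto simp: tensor_map_def)
  have "(\<Sum>ls | length ls = length es. haar (tensor_power u es ls js) *\<^sub>C tensor_power u es is ls) =
      haar (tensor_power u es is js) *\<^sub>C 1" if "length is = length es" for "is"
    using h(2)[of "tensor_power u es is js"]
    by (simp add: comult_tensor_power[OF that assms(2)] clinear_sum[OF lin] ht)
  then show ?thesis
    by (auto simp: Fix_def haar_matrix_def intro!: sum.cong)
qed

lemma haar_matrix_fixes_Fix:
  assumes "clinear haar" "haar 1 = 1" "\<xi> \<in> Fix u es"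
  shows "(\<Sum>js | length js = length es. haar_matrix haar u es is js * \<xi> js) = \<xi> is"
proof (cases "length is = length es")
  case True
  then have "haar (\<Sum>js | length js = length es. \<xi> js *\<^sub>C tensor_power u es is js) = haar (\<xi> is *\<^sub>C 1)"
    using assms(3) by (simp add: Fix_def)
  then show ?thesis
    using True assms(2)
    by (simp add: haar_matrix_def clinear_sum[OF assms(1)] clinear_scaleC[OF assms(1)]
        scaleC_complex_def mult.commute)
next
  case False
  then show ?thesis using assms(3) by (simp add: Fix_def haar_matrix_def)
qed

lemma haar_matrix_left_Fix:
  assumes "clinear haar" "haar 1 = 1" "\<xi> \<in> Fix u es" "length js = length es"
  shows "(\<Sum>is | length is = length es. cnj (\<xi> is) * haar_matrix haar u es is js) = cnj (\<xi> js)"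
proof -
  have "haar (\<Sum>is | length is = length es. cnj (\<xi> is) *\<^sub>C tensor_power u es is js) =
      haar (cnj (\<xi> js) *\<^sub>C 1)"
    by (simp only: Fix_left_invariant[OF assms(3,4)])
  then show ?thesis
    using assms(2)
    by (simp add: haar_matrix_def clinear_sum[OF assms(1)] clinear_scaleC[OF assms(1)]
        scaleC_complex_def)
qed

end

section \<open>Orthogonal projections in terms of a basis\<close>

text \<open>Tensors supported on the words of length \<open>k\<close> form a finite-dimensional space.\<close>

lemma tensor_basis_finite:
  assumes basis: "tensor_basis D \<xi> V"
    and supp: "\<And>\<eta> is. \<eta> \<in> V \<Longrightarrow> length (is :: 'n::finite list) \<noteq> k \<Longrightarrow> \<eta> is = 0"
  shows "finite D"
proof -
  let ?e = "\<lambda>js is :: 'n list. if is = js then 1 else 0 :: complex"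
  let ?E = "?e ` {js. length js = k}"
  have in_span: "\<eta> \<in> tensors.span ?E" if "\<eta> \<in> V" for \<eta>
  proof -
    have "\<eta> = (\<Sum>js | length js = k. (\<lambda>is. \<eta> js * ?e js is))"
    proof
      fix "is"
      show "\<eta> is = (\<Sum>js | length js = k. (\<lambda>is. \<eta> js * ?e js is)) is"
        using supp[OF that, of "is"]
        by (simp add: sum_fun_apply finite_lists_of_length if_distrib cong: if_cong)
    qed
    also have "\<dots> \<in> tensors.span ?E"
      by (intro tensors.span_sum tensors.span_scale tensors.span_base) auto
    finally show ?thesis .
  qed
  have sub: "\<xi> ` D \<subseteq> V" and ind: "\<not> tensors.dependent (\<xi> ` D)" and inj: "inj_on \<xi> D"
    using basis tensors.span_superset[of "\<xi> ` D"] by (auto simp: tensor_basis_def)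
  have "finite ?E"
    by (intro finite_imageI finite_lists_of_length)
  moreover have "\<xi> ` D \<subseteq> tensors.span ?E"
    using sub in_span by blast
  ultimately have "finite (\<xi> ` D)"
    using tensors.independent_span_bound[OF _ ind] by blast
  then show ?thesis
    using inj by (rule finite_imageD)
qed

lemma tensor_basis_coordinates:
  assumes "tensor_basis D \<xi> V" "finite D" "\<eta> \<in> V"
  obtains c where "\<And>is. \<eta> is = (\<Sum>\<pi>\<in>D. c \<pi> * \<xi> \<pi> is)"
proof -
  have inj: "inj_on \<xi> D" and "\<eta> \<in> tensors.span (\<xi> ` D)"
    using assms by (auto simp: tensor_basis_def)
  then obtain a where "\<eta> = (\<Sum>v\<in>\<xi> ` D. (\<lambda>is. a v * v is))"
    using tensors.span_finite[of "\<xi> ` D"] assms(2) by auto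
  then have "\<eta> is = (\<Sum>\<pi>\<in>D. a (\<xi> \<pi>) * \<xi> \<pi> is)" for "is"
    using inj by (simp add: sum_fun_apply sum.reindex)
  then show thesis by (rule that)
qed

lemma tensor_basis_independent:
  assumes "tensor_basis D \<xi> V" "finite D" "\<And>is. (\<Sum>\<pi>\<in>D. c \<pi> * \<xi> \<pi> is) = 0" "\<pi> \<in> D"
  shows "c \<pi> = 0"
proof -
  have inj: "inj_on \<xi> D" and ind: "\<not> tensors.dependent (\<xi> ` D)"
    using assms by (auto simp: tensor_basis_def)
  let ?a = "\<lambda>v. c (the_inv_into D \<xi> v)"
  have "(\<Sum>v\<in>\<xi> ` D. (\<lambda>is. ?a v * v is)) = 0"
    using assms(3) inj by (simp add: fun_eq_iff sum_fun_apply sum.reindex the_inv_into_f_f)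
  then have "?a (\<xi> \<pi>) = 0"
    using assms(2,4) by (intro tensors.independentD[OF ind, of "\<xi> ` D"]) auto
  then show ?thesis
    using inj assms(4) by (simp add: the_inv_into_f_f)
qed

lemma inverse_matrix_onI:
  assumes fin: "finite D"
    and right: "\<And>\<pi> \<sigma>. \<pi> \<in> D \<Longrightarrow> \<sigma> \<in> D \<Longrightarrow> (\<Sum>\<tau>\<in>D. M \<pi> \<tau> * W \<tau> \<sigma>) = (if \<pi> = \<sigma> then 1 else 0)"
    and left: "\<And>\<pi> \<sigma>. \<pi> \<in> D \<Longrightarrow> \<sigma> \<in> D \<Longrightarrow> (\<Sum>\<tau>\<in>D. W \<pi> \<tau> * M \<tau> \<sigma>) = (if \<pi> = \<sigma> then 1 else 0)"
    and D: "\<pi> \<in> D" "\<sigma> \<in> D"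
  shows "inverse_matrix_on D M \<pi> \<sigma> = W \<pi> \<sigma>"
proof -
  let ?W = "\<lambda>\<pi> \<sigma>. if \<pi> \<in> D \<and> \<sigma> \<in> D then W \<pi> \<sigma> else 0"
  have "inverse_matrix_on D M = ?W"
    unfolding inverse_matrix_on_def
  proof (rule the_equality, goal_cases)
    case 1
    show ?case using right left by simp
  next
    case (2 V)
    \<comment> \<open>uniqueness: \<open>V = (W M) V = W (M V) = W\<close>\<close>
    have "V \<pi> \<sigma> = ?W \<pi> \<sigma>" for \<pi> \<sigma>
    proof (cases "\<pi> \<in> D \<and> \<sigma> \<in> D")
      case True
      have "V \<pi> \<sigma> = (\<Sum>\<rho>\<in>D. (\<Sum>\<tau>\<in>D. W \<pi> \<tau> * M \<tau> \<rho>) * V \<rho> \<sigma>)"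
        using True left fin by (simp add: if_distrib[of "\<lambda>a. a * _"] cong: if_cong)
      also have "\<dots> = (\<Sum>\<tau>\<in>D. W \<pi> \<tau> * (\<Sum>\<rho>\<in>D. M \<tau> \<rho> * V \<rho> \<sigma>))"
        by (simp add: sum_distrib_left sum_distrib_right mult.assoc) (rule sum.swap)
      also have "\<dots> = W \<pi> \<sigma>"
        using True 2 fin by (simp add: if_distrib[of "\<lambda>a. _ * a"] cong: if_cong)
      finally show ?thesis using True by simp
    next
      case False
      then show ?thesis using 2 by auto
    qed
    then show ?case by (intro ext)
  qed
  then show ?thesis using D by simp
qed

text \<open>The assumptions say that \<open>P\<close> is the orthogonal projection onto \<open>V\<close>. Let \<open>F\<close> be the
  matrix whose columns are the coordinates of the columns of \<open>P\<close>. The rows of \<open>F\<close>,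
  conjugated, form a family biorthogonal to \<open>\<xi>\<close>, because \<open>P\<close> fixes the basis vectors. Therefore \<open>F F\<^sup>*\<close> is a right inverse of the Gram matrix, and a
  two-sided one because both matrices are Hermitian.\<close>

lemma weingarten_projection:
  fixes P :: "'n::finite list \<Rightarrow> 'n list \<Rightarrow> complex"
  assumes basis: "tensor_basis D \<xi> V" and fin: "finite D"
    and column: "\<And>js. length js = k \<Longrightarrow> (\<lambda>is. P is js) \<in> V"
    and fixed: "\<And>\<eta> is. \<eta> \<in> V \<Longrightarrow> (\<Sum>js | length js = k. P is js * \<eta> js) = \<eta> is"
    and adjoint: "\<And>\<eta> js. \<eta> \<in> V \<Longrightarrow> length js = k \<Longrightarrow>
        (\<Sum>is | length is = k. cnj (\<eta> is) * P is js) = cnj (\<eta> js)"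
  shows "(\<Sum>js | length js = k. P is js * \<eta> js) =
    (\<Sum>\<pi>\<in>D. \<Sum>\<sigma>\<in>D. \<xi> \<pi> is * tensor_inner k (\<xi> \<sigma>) \<eta> * weingarten k D \<xi> \<pi> \<sigma>)"
proof -
  let ?L = "{js :: 'n list. length js = k}"
  have "\<exists>F. \<forall>js\<in>?L. \<forall>is. P is js = (\<Sum>\<pi>\<in>D. F js \<pi> * \<xi> \<pi> is)"
    by (intro bchoice ballI) (metis (mono_tags) column mem_Collect_eq tensor_basis_coordinates[OF basis fin])
  then obtain F where F: "\<And>is js. js \<in> ?L \<Longrightarrow> P is js = (\<Sum>\<pi>\<in>D. F js \<pi> * \<xi> \<pi> is)"
    by blast
  define coord where "coord \<eta> \<pi> = (\<Sum>js\<in>?L. F js \<pi> * \<eta> js)" for \<eta> \<pi>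
  have P_coord: "(\<Sum>js\<in>?L. P is js * \<eta> js) = (\<Sum>\<pi>\<in>D. coord \<eta> \<pi> * \<xi> \<pi> is)" for \<eta> "is"
  proof -
    have "(\<Sum>js\<in>?L. P is js * \<eta> js) = (\<Sum>js\<in>?L. \<Sum>\<pi>\<in>D. F js \<pi> * \<eta> js * \<xi> \<pi> is)"
      by (intro sum.cong) (simp_all add: F sum_distrib_left sum_distrib_right mult_ac)
    also have "\<dots> = (\<Sum>\<pi>\<in>D. coord \<eta> \<pi> * \<xi> \<pi> is)"
      by (subst sum.swap) (simp add: coord_def sum_distrib_right)
    finally show ?thesis .
  qed
  have \<xi>V: "\<xi> \<pi> \<in> V" if "\<pi> \<in> D" for \<pi>
    using basis that tensors.span_base[of "\<xi> \<pi>" "\<xi> ` D"] by (auto simp: tensor_basis_def)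
  \<comment> \<open>biorthogonality: compare \<open>P \<xi>\<^sub>\<sigma> = \<xi>\<^sub>\<sigma>\<close> with its expansion in the basis\<close>
  have coord_basis: "coord (\<xi> \<sigma>) \<pi> = (if \<pi> = \<sigma> then 1 else 0)" if "\<pi> \<in> D" "\<sigma> \<in> D" for \<pi> \<sigma>
  proof -
    have "(\<Sum>\<pi>\<in>D. (coord (\<xi> \<sigma>) \<pi> - (if \<pi> = \<sigma> then 1 else 0)) * \<xi> \<pi> is) = 0" for "is"
      using fixed[OF \<xi>V[OF that(2)]] that(2) fin
      by (simp add: P_coord left_diff_distrib sum_subtractf if_distrib[of "\<lambda>a. a * _"] cong: if_cong)
    from tensor_basis_independent[OF basis fin this that(1)] show ?thesis by simp
  qed
  \<comment> \<open>\<open>\<langle>\<xi>\<^sub>\<sigma>, P \<eta>\<rangle> = \<langle>\<xi>\<^sub>\<sigma>, \<eta>\<rangle>\<close> with \<open>P \<eta>\<close> expanded in the basis\<close>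
  have gram_coord: "(\<Sum>\<tau>\<in>D. gram k \<xi> \<sigma> \<tau> * coord \<eta> \<tau>) = tensor_inner k (\<xi> \<sigma>) \<eta>"
    if "\<sigma> \<in> D" for \<sigma> \<eta>
  proof -
    have "(\<Sum>\<tau>\<in>D. gram k \<xi> \<sigma> \<tau> * coord \<eta> \<tau>) =
        (\<Sum>is\<in>?L. cnj (\<xi> \<sigma> is) * (\<Sum>\<tau>\<in>D. coord \<eta> \<tau> * \<xi> \<tau> is))"
      unfolding gram_def tensor_inner_def sum_distrib_left sum_distrib_right
      by (subst sum.swap) (simp add: mult_ac)
    also have "\<dots> = (\<Sum>is\<in>?L. cnj (\<xi> \<sigma> is) * (\<Sum>js\<in>?L. P is js * \<eta> js))"
      by (simp only: P_coord)
    also have "\<dots> = (\<Sum>js\<in>?L. (\<Sum>is\<in>?L. cnj (\<xi> \<sigma> is) * P is js) * \<eta> js)"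
      by (simp add: sum_distrib_left sum_distrib_right mult.assoc) (rule sum.swap)
    also have "\<dots> = tensor_inner k (\<xi> \<sigma>) \<eta>"
      using adjoint[OF \<xi>V[OF that]] by (simp add: tensor_inner_def)
    finally show ?thesis .
  qed
  define W where "W \<pi> \<sigma> = (\<Sum>js\<in>?L. F js \<pi> * cnj (F js \<sigma>))" for \<pi> \<sigma>
  \<comment> \<open>The column \<open>W(\<cdot>,\<sigma>)\<close> holds the coordinates of \<open>P \<zeta>\<close>, where \<open>\<zeta>\<close> is the conjugated row \<open>\<sigma>\<close> of \<open>F\<close>;
    its inner products with the basis vectors are given by biorthogonality.\<close>
  have right: "(\<Sum>\<tau>\<in>D. gram k \<xi> \<pi> \<tau> * W \<tau> \<sigma>) = (if \<pi> = \<sigma> then 1 else 0)"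
    if "\<pi> \<in> D" "\<sigma> \<in> D" for \<pi> \<sigma>
  proof -
    have "(\<Sum>\<tau>\<in>D. gram k \<xi> \<pi> \<tau> * W \<tau> \<sigma>) = cnj (coord (\<xi> \<pi>) \<sigma>)"
      using gram_coord[OF that(1), of "\<lambda>js. cnj (F js \<sigma>)"]
      by (simp add: W_def coord_def tensor_inner_def mult.commute)
    then show ?thesis using coord_basis[OF that(2,1)] by auto
  qed
  have gram_cnj: "cnj (gram k \<xi> \<pi> \<sigma>) = gram k \<xi> \<sigma> \<pi>" for \<pi> \<sigma>
    by (simp add: gram_def tensor_inner_def mult.commute)
  have W_cnj: "cnj (W \<pi> \<sigma>) = W \<sigma> \<pi>" for \<pi> \<sigma>
    by (simp add: W_def mult.commute)
  \<comment> \<open>the conjugate transpose of the identity \<open>right\<close>\<close>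
  have left: "(\<Sum>\<tau>\<in>D. W \<pi> \<tau> * gram k \<xi> \<tau> \<sigma>) = (if \<pi> = \<sigma> then 1 else 0)"
    if "\<pi> \<in> D" "\<sigma> \<in> D" for \<pi> \<sigma>
  proof -
    have "(\<Sum>\<tau>\<in>D. W \<pi> \<tau> * gram k \<xi> \<tau> \<sigma>) = cnj (\<Sum>\<tau>\<in>D. gram k \<xi> \<sigma> \<tau> * W \<tau> \<pi>)"
      by (simp add: gram_cnj W_cnj mult.commute)
    then show ?thesis using right[OF that(2,1)] by auto
  qed
  have weingarten: "weingarten k D \<xi> \<pi> \<sigma> = W \<pi> \<sigma>" if "\<pi> \<in> D" "\<sigma> \<in> D" for \<pi> \<sigma>
    unfolding weingarten_def by (rule inverse_matrix_onI[OF fin right left that])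
  have "coord \<eta> \<pi> = (\<Sum>\<sigma>\<in>D. weingarten k D \<xi> \<pi> \<sigma> * tensor_inner k (\<xi> \<sigma>) \<eta>)" if "\<pi> \<in> D" for \<pi>
  proof -
    have "(\<Sum>\<sigma>\<in>D. weingarten k D \<xi> \<pi> \<sigma> * tensor_inner k (\<xi> \<sigma>) \<eta>) =
        (\<Sum>\<sigma>\<in>D. W \<pi> \<sigma> * (\<Sum>\<tau>\<in>D. gram k \<xi> \<sigma> \<tau> * coord \<eta> \<tau>))"
      using that by (simp add: weingarten gram_coord)
    also have "\<dots> = (\<Sum>\<tau>\<in>D. (\<Sum>\<sigma>\<in>D. W \<pi> \<sigma> * gram k \<xi> \<sigma> \<tau>) * coord \<eta> \<tau>)"
      by (simp add: sum_distrib_left sum_distrib_right mult.assoc) (rule sum.swap)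
    also have "\<dots> = coord \<eta> \<pi>"
      using that fin by (simp add: left if_distrib[of "\<lambda>a. a * _"] cong: if_cong)
    finally show ?thesis by simp
  qed
  then show ?thesis
    unfolding P_coord by (simp add: sum_distrib_left sum_distrib_right mult_ac)
qed

section \<open>Moments of the coordinates\<close>

theorem proposition4p2:
  fixes u :: "'n::finite \<Rightarrow> 'n \<Rightarrow> 'g::cstar_algebra"
    and tGG :: "'g \<Rightarrow> 'g \<Rightarrow> 'gg::cstar_algebra"
    and \<Delta> :: "'g \<Rightarrow> 'gg" and \<epsilon> :: "'g \<Rightarrow> complex" and S :: "'g \<Rightarrow> 'g"
    and haar :: "'g \<Rightarrow> complex"
    and tGX :: "'g \<Rightarrow> 'x::cstar_algebra \<Rightarrow> 'gx::cstar_algebra"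
    and tG_GX :: "'g \<Rightarrow> 'gx \<Rightarrow> 'ggx::cstar_algebra"
    and tGG_X :: "'gg \<Rightarrow> 'x \<Rightarrow> 'ggx"
    and \<alpha> :: "'x \<Rightarrow> 'g" and \<Phi> :: "'x \<Rightarrow> 'gx"
    and v :: "'n \<Rightarrow> 'n \<Rightarrow> 'v::cstar_algebra" and \<rho> :: "'v \<Rightarrow> 'g"
    and z :: "'n \<Rightarrow> 's::cstar_algebra" and q :: "'s \<Rightarrow> 'x"
    and x :: "'n \<Rightarrow> 'x"
    and I :: "'n set"
    and es :: "color list" and "is" :: "'n list"
    and D :: "'d set" and \<xi> :: "'d \<Rightarrow> 'n list \<Rightarrow> complex"
  assumes "affine_homogeneous_space u tGG \<Delta> \<epsilon> S haar tGX tG_GX tGG_X \<alpha> \<Phi> v \<rho> z q x I"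
    and "length is = length es"
    and "tensor_basis D \<xi> (Fix u es)"
  shows "haar (\<alpha> (monomial x (zip is es))) =
    (\<Sum>\<pi>\<in>D. \<Sum>\<sigma>\<in>D. \<xi> \<pi> is * K_coeff (length es) I \<xi> \<sigma> * weingarten (length es) D \<xi> \<pi> \<sigma>)"
proof -
  interpret affine_homogeneous_space u tGG \<Delta> \<epsilon> S haar tGX tG_GX tGG_X \<alpha> \<Phi> v \<rho> z q x I
    by (fact assms(1))
  let ?k = "length es"
  let ?P = "haar_matrix haar u es"
  let ?\<eta> = "\<lambda>bs. if set bs \<subseteq> I then 1 else 0 :: complex"
  define c where "c = 1 / sqrt (card I)"
  have lin: "clinear haar" and one: "haar 1 = 1"
    using haar by (auto simp: haar_state_def)
  have c: "complex_of_real (c ^ ?k) = 1 / complex_of_real (sqrt (real (card I) ^ ?k))"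
    by (simp add: c_def power_one_over real_sqrt_power)
  have fin: "finite D"
    using tensor_basis_finite[OF assms(3), of ?k] by (auto simp: Fix_def)
  have restrict: "(\<Sum>bs | length bs = ?k \<and> set bs \<subseteq> I. f bs) = (\<Sum>bs | length bs = ?k. f bs * ?\<eta> bs)"
    for f :: "'n list \<Rightarrow> complex"
    by (rule sum.mono_neutral_cong_left) (auto simp: finite_lists_of_length)
  have K: "K_coeff ?k I \<xi> \<sigma> = complex_of_real (c ^ ?k) * tensor_inner ?k (\<xi> \<sigma>) ?\<eta>" for \<sigma>
    unfolding K_coeff_def c tensor_inner_def restrict ..
  have "haar (\<alpha> (monomial x (zip is es))) =
      haar (complex_of_real (c ^ ?k) *\<^sub>C
        (\<Sum>bs | length bs = ?k \<and> set bs \<subseteq> I. tensor_power u es is bs))"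
    using monomial_row_sums[OF assms(2), of I c u]
    by (simp add: cstar_hom_monomial[OF alpha_hom] alpha_coord c_def scaleR_scaleC)
  also have "\<dots> = complex_of_real (c ^ ?k) * (\<Sum>bs | length bs = ?k. ?P is bs * ?\<eta> bs)"
    unfolding restrict[symmetric] using assms(2)
    by (simp add: clinear_sum[OF lin] clinear_scaleC[OF lin] scaleC_complex_def haar_matrix_def)
  also have "(\<Sum>bs | length bs = ?k. ?P is bs * ?\<eta> bs) =
      (\<Sum>\<pi>\<in>D. \<Sum>\<sigma>\<in>D. \<xi> \<pi> is * tensor_inner ?k (\<xi> \<sigma>) ?\<eta> * weingarten ?k D \<xi> \<pi> \<sigma>)"
    by (rule weingarten_projection[OF assms(3) fin])
      (use haar lin one in \<open>auto intro: haar_matrix_column_fixed haar_matrix_fixes_Fix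
        haar_matrix_left_Fix\<close>)
  finally show ?thesis
    unfolding K by (simp add: sum_distrib_left mult_ac)
qed

end
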